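(* Let $V,W$ be reflexive, separable Banach spaces and $Y,X$ Hilbert spaces such that we have the Gelfand triples $$V\hookrightarrow Y\hookrightarrow V',\qquad W\hookrightarrow X\hookrightarrow W',$$ with continuous and dense embeddings, where $Y$ and $X$ are identified with their dual spaces $Y'$ and $X'$ via the Riesz representation theorem. Let $A\in\mathcal L(Y,X)$ and let $A^*\in\mathcal L(X,Y)$ denote the adjoint operator of $A$. If $A^*(W)\subset V$ with $\|A^*w\|_V\le C\|w\|_W$ for all $w\in W$ (for some constant $C$), and $u\in L^2((0,T),Y)\cap H^1((0,T),V')$, then $\partial_tAu\in L^2((0,T),W')$ with $$\langle\partial_tAu,w\rangle_{W',W}=\langle\partial_tu,A^*w\rangle_{V',V}\quad\text{for all }w\in W.$$
   Context: $T>0$. The operator $A$ is applied to $u$ pointwise in $t\in(0,T)$. Time derivatives are generalized derivatives in the respective Gelfand triples: $\partial_tu\in L^2((0,T),V')$ is characterized by $\int_0^T\langle\partial_tu,v\rangle_{V',V}\psi\,dt=-\int_0^T(u,v)_Y\psi'\,dt$ for all $v\in V$, $\psi\in C_0^\infty(0,T)$, and analogously $\partial_tAu$ with $W,X$ in place of $V,Y$. The identity in the conclusion holds for almost every $t\in(0,T)$. *)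

theory Defs
  imports "HOL-Analysis.Analysis"
begin

text \<open>
  Banach spaces are types of class \<open>banach\<close>, Hilbert spaces are types of class
  \<open>real_inner\<close> and \<open>banach\<close>, and the dual of \<open>'v\<close> is \<open>'v \<Rightarrow>\<^sub>L real\<close> with the
  operator norm. An inclusion \<open>V \<subseteq> Y\<close> of spaces is represented by an injective map
  \<open>j :: 'v \<Rightarrow>\<^sub>L 'y\<close>, so that an element \<open>y\<close> of \<open>Y\<close> lies in \<open>V\<close> iff \<open>y \<in> range j\<close>,
  and is then the element \<open>inv j y\<close> of \<open>V\<close>.
\<close>

text \<open>Surjectivity of the canonical map into the bidual.\<close>

definition reflexive_space :: "'v::real_normed_vector itself \<Rightarrow> bool" where
  "reflexive_space _ \<longleftrightarrow>
     (\<forall>\<phi> :: ('v \<Rightarrow>\<^sub>L real) \<Rightarrow>\<^sub>L real. \<exists>v. \<forall>f. blinfun_apply \<phi> f = blinfun_apply f v)"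

definition dense_embedding :: "('a::real_normed_vector \<Rightarrow> 'b::real_normed_vector) \<Rightarrow> bool" where
  "dense_embedding f \<longleftrightarrow> bounded_linear f \<and> inj f \<and> closure (range f) = UNIV"

text \<open>
  The map \<open>Y \<cong> Y' \<rightarrow> V'\<close>: the Riesz isomorphism followed by restriction to \<open>V\<close>.
\<close>

definition gelfand_embed ::
    "('v::real_normed_vector \<Rightarrow>\<^sub>L 'y::real_inner) \<Rightarrow> 'y \<Rightarrow> ('v \<Rightarrow>\<^sub>L real)" where
  "gelfand_embed j y = blinfun_inner_right y o\<^sub>L j"

lemma gelfand_embed_apply: "blinfun_apply (gelfand_embed j y) v = y \<bullet> blinfun_apply j v"
  by (simp add: gelfand_embed_def)

definition gelfand_triple :: "('v::real_normed_vector \<Rightarrow>\<^sub>L 'y::real_inner) \<Rightarrow> bool" where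
  "gelfand_triple j \<longleftrightarrow>
     dense_embedding (blinfun_apply j) \<and> dense_embedding (gelfand_embed j)"

text \<open>
  Bochner measurability. The library's Bochner integral needs a second countable
  target, which the type \<open>'v \<Rightarrow>\<^sub>L real\<close> is not known to be; this definition does not.
\<close>

definition strongly_measurable :: "'a measure \<Rightarrow> ('a \<Rightarrow> 'b::real_normed_vector) \<Rightarrow> bool" where
  "strongly_measurable M f \<longleftrightarrow>
     (\<exists>s. (\<forall>n::nat. simple_function M (s n)) \<and> (AE t in M. (\<lambda>n. s n t) \<longlonglongrightarrow> f t))"

text \<open>The function \<open>f\<close> represents an element of \<open>L\<^sup>2((0,T),B)\<close>; its values outside \<open>(0,T)\<close> are irrelevant.\<close>

definition bochner_L2 :: "real \<Rightarrow> (real \<Rightarrow> 'b::real_normed_vector) \<Rightarrow> bool" where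
  "bochner_L2 T f \<longleftrightarrow>
     strongly_measurable (lebesgue_on {0<..<T}) f \<and>
     integrable (lebesgue_on {0<..<T}) (\<lambda>t. (norm (f t))\<^sup>2)"

text \<open>\<open>C\<^sub>0\<^sup>\<infinity>(0,T)\<close>, with functions extended by zero to the whole line.\<close>

definition test_functions :: "real \<Rightarrow> (real \<Rightarrow> real) set" where
  "test_functions T =
     {\<psi>. (\<forall>n t. (deriv ^^ n) \<psi> differentiable (at t)) \<and>
         (\<exists>K. compact K \<and> K \<subseteq> {0<..<T} \<and> (\<forall>t. t \<notin> K \<longrightarrow> \<psi> t = 0))}"

text \<open>
  The function \<open>g\<close> represents the generalized derivative \<open>\<partial>\<^sub>t u \<in> L\<^sup>2((0,T),V')\<close> of the
  \<open>Y\<close>-valued function \<open>u\<close>. It is determined only up to null sets, hence a relation.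
\<close>

definition has_gelfand_deriv ::
    "real \<Rightarrow> ('v::real_normed_vector \<Rightarrow>\<^sub>L 'y::real_inner) \<Rightarrow> (real \<Rightarrow> 'y) \<Rightarrow> (real \<Rightarrow> ('v \<Rightarrow>\<^sub>L real)) \<Rightarrow> bool"
  where
  "has_gelfand_deriv T j u g \<longleftrightarrow>
     bochner_L2 T g \<and>
     (\<forall>v. \<forall>\<psi>\<in>test_functions T.
        (LINT t|lebesgue_on {0<..<T}. blinfun_apply (g t) v * \<psi> t) =
        - (LINT t|lebesgue_on {0<..<T}. (u t \<bullet> blinfun_apply j v) * deriv \<psi> t))"

text \<open>The \<open>Y\<close>-valued function \<open>u\<close>, viewed as \<open>V'\<close>-valued, lies in \<open>H\<^sup>1((0,T),V')\<close>.\<close>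

definition in_H1_dual ::
    "real \<Rightarrow> ('v::real_normed_vector \<Rightarrow>\<^sub>L 'y::real_inner) \<Rightarrow> (real \<Rightarrow> 'y) \<Rightarrow> bool" where
  "in_H1_dual T j u \<longleftrightarrow>
     bochner_L2 T (\<lambda>t. gelfand_embed j (u t)) \<and> (\<exists>g. has_gelfand_deriv T j u g)"

end

theory Submission
  imports Defs
begin

text \<open>
  Since \<open>A\<^sup>*\<close> maps \<open>W\<close> boundedly into \<open>V\<close>, it induces a bounded operator \<open>B : W \<rightarrow> V\<close>, and
  testing the weak derivative of \<open>u\<close> with \<open>B w\<close> shows that \<open>(\<partial>\<^sub>t u) \<circ> B\<close> is a weak derivative
  of \<open>A u\<close>. Weak derivatives are unique almost everywhere: two of them agree on each fixed \<open>w\<close> by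
  the fundamental lemma of the calculus of variations, and a countable dense subset of \<open>W\<close>
  makes the exceptional null set independent of \<open>w\<close>. The fundamental lemma needs no mollifiers:
  the test functions \<open>exp (- e / (t - a - e) - e / (b - e - t))\<close> are bounded by 1 and converge to
  the indicator of \<open>(a, b)\<close> as \<open>e\<close> tends to 0, so the function integrates to zero over every
  interval.
\<close>

section \<open>Riesz representation and the Hilbert space adjoint\<close>

text \<open>The representing vector is the minimizer of \<open>y \<bullet> y - 2 * f y\<close>, found as the limit of a minimizing sequence.\<close>

lemma riesz_representation:
  fixes f :: "'a::{real_inner,banach} \<Rightarrow> real"
  assumes "bounded_linear f"
  shows "\<exists>z. \<forall>y. f y = y \<bullet> z"
proof -
  interpret bounded_linear f by fact
  define J where "J y = y \<bullet> y - 2 * f y" for y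
  obtain K where K: "\<And>y. norm (f y) \<le> norm y * K"
    using pos_bounded by blast
  have J_ge: "- (K\<^sup>2) \<le> J y" for y
  proof -
    have "f y \<le> norm y * K"
      using K[of y] by simp
    \<comment> \<open>Completing the square: \<open>J y\<close> is at least
      \<open>(norm y)^2 - 2 * K * norm y\<close>, which is at least \<open>- K^2\<close>.\<close>
    moreover have "0 \<le> (norm y - K)\<^sup>2"
      by simp
    ultimately show ?thesis
      unfolding J_def by (simp add: power2_diff dot_square_norm)
  qed
  then have bdd: "bdd_below (range J)"
    by (auto intro!: bdd_belowI)
  define m where "m = Inf (range J)"
  have m_le: "m \<le> J y" for y
    unfolding m_def by (rule cInf_lower[OF _ bdd]) auto
  have "\<exists>y. J y < m + 1 / (real n + 1)" for n
    using cInf_lessD[of "range J" "m + 1 / (real n + 1)"] by (auto simp: m_def)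
  then obtain s where s: "\<And>n. J (s n) < m + 1 / (real n + 1)"
    by metis
  \<comment> \<open>The linear terms cancel at the midpoint. Since \<open>J\<close> is at least
    \<open>m\<close> there, two near-minimizers must be close to each other.\<close>
  have parallelogram: "(norm (x - y))\<^sup>2 / 2 = J x + J y - 2 * J ((1/2) *\<^sub>R (x + y))" for x y
    by (simp add: J_def scaleR add inner_add_left inner_add_right inner_diff_left inner_diff_right
        inner_commute power2_norm_eq_inner field_simps)
  have dist_s: "(norm (s k - s l))\<^sup>2 \<le> 4 / (real n + 1)" if "k \<ge> n" "l \<ge> n" for k l n
  proof -
    have "(norm (s k - s l))\<^sup>2 / 2 \<le> 1 / (real k + 1) + 1 / (real l + 1)"
      using parallelogram[of "s k" "s l"] s[of k] s[of l] m_le[of "(1/2) *\<^sub>R (s k + s l)"]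
      by linarith
    moreover have "1 / (real k + 1) \<le> 1 / (real n + 1)" "1 / (real l + 1) \<le> 1 / (real n + 1)"
      using that by (auto intro!: divide_left_mono)
    ultimately show ?thesis
      by linarith
  qed
  have "Cauchy s"
  proof (rule CauchyI)
    fix e :: real assume "0 < e"
    then obtain n :: nat where "4 / e\<^sup>2 < real n"
      using reals_Archimedean2 by blast
    then have "4 / (real n + 1) < e\<^sup>2"
      using \<open>0 < e\<close> by (simp add: field_simps) (smt (verit) zero_le_power2)
    then show "\<exists>M. \<forall>k\<ge>M. \<forall>l\<ge>M. norm (s k - s l) < e"
      using dist_s \<open>0 < e\<close>
      by (meson le_less_trans less_imp_le power2_less_imp_less)
  qed
  then obtain z where z: "s \<longlonglongrightarrow> z"
    using Cauchy_convergent convergentD by blast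
  have "(\<lambda>n. J (s n)) \<longlonglongrightarrow> J z"
    unfolding J_def by (intro tendsto_intros tendsto z)
  moreover have "(\<lambda>n. m + 1 / (real n + 1)) \<longlonglongrightarrow> m"
    using tendsto_add[OF tendsto_const[of m] LIMSEQ_inverse_real_of_nat]
    by (simp add: inverse_eq_divide add.commute)
  ultimately have Jz: "J z \<le> J y" for y
    using LIMSEQ_le[of "\<lambda>n. J (s n)" "J z" "\<lambda>n. m + 1 / (real n + 1)" m] s m_le[of y]
    by (meson less_imp_le order_trans)
  have "f y = y \<bullet> z" for y
  proof (cases "y = 0")
    case False
    \<comment> \<open>This \<open>t\<close> minimizes \<open>J\<close> on the line through
      \<open>z\<close> in direction \<open>y\<close>. Minimality of \<open>z\<close> then forces the
      resulting decrease to vanish.\<close>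
    define t where "t = (f y - y \<bullet> z) / (y \<bullet> y)"
    have "J (z + t *\<^sub>R y) = J z - (f y - y \<bullet> z)\<^sup>2 / (y \<bullet> y)"
      using False
      by (simp add: J_def t_def scaleR add inner_add_left inner_add_right inner_commute[of z y]
          field_simps power2_eq_square)
    with Jz[of "z + t *\<^sub>R y"] have "(f y - y \<bullet> z)\<^sup>2 / (y \<bullet> y) \<le> 0"
      by simp
    moreover have "0 < y \<bullet> y" using False by simp
    ultimately show ?thesis
      by (simp add: divide_le_0_iff)
  qed (simp add: zero)
  then show ?thesis by blast
qed

text \<open>\<open>adjoint\<close> is defined by choice, so its characteristic identity is available
  only once some adjoint is known to exist. Riesz representation, applied for each fixed
  \<open>y\<close>, supplies one.\<close>

lemma inner_adjoint_hilbert: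
  fixes f :: "'a::{real_inner,banach} \<Rightarrow> 'b::real_inner"
  assumes "bounded_linear f"
  shows "x \<bullet> adjoint f y = f x \<bullet> y"
proof -
  have "\<exists>z. \<forall>x. f x \<bullet> y = x \<bullet> z" for y
    by (intro riesz_representation bounded_linear_inner_left_comp assms)
  then obtain g where "\<forall>x y. f x \<bullet> y = x \<bullet> g y"
    by metis
  then show ?thesis
    using adjoint_unique by metis
qed

lemma linear_adjoint_hilbert:
  fixes f :: "'a::{real_inner,banach} \<Rightarrow> 'b::real_inner"
  assumes "bounded_linear f"
  shows "linear (adjoint f)"
proof (rule linearI)
  show "adjoint f (x + y) = adjoint f x + adjoint f y" for x y
    by (simp add: vector_eq_ldot[symmetric] inner_adjoint_hilbert[OF assms] inner_add_right)
  show "adjoint f (c *\<^sub>R x) = c *\<^sub>R adjoint f x" for c x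
    by (simp add: vector_eq_ldot[symmetric] inner_adjoint_hilbert[OF assms])
qed

section \<open>Smooth bump functions\<close>

text \<open>Exponential decay beats each monomial, and the finitely many terms are summed. Under the
  substitution of \<open>inverse x\<close> for \<open>x\<close> this becomes the flatness of
  \<open>bump_fun\<close> at 0.\<close>

lemma poly_mult_exp_tendsto_0:
  fixes p :: "real poly"
  assumes "c > 0"
  shows "((\<lambda>x. poly p x * exp (- c * x)) \<longlongrightarrow> 0) at_top"
proof -
  have "((\<lambda>x. x ^ k * exp (- c * x)) \<longlongrightarrow> 0) at_top" for k
  proof -
    have "((\<lambda>x. (1 / c ^ k) * ((c * x) ^ k / exp (c * x))) \<longlongrightarrow> (1 / c ^ k) * 0) at_top"
      by (intro tendsto_intros filterlim_compose[OF tendsto_power_div_exp_0]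
          filterlim_tendsto_pos_mult_at_top[OF tendsto_const assms filterlim_ident])
    moreover have "(1 / c ^ k) * ((c * x) ^ k / exp (c * x)) = x ^ k * exp (- c * x)" for x
      using assms by (simp add: power_mult_distrib exp_minus field_simps)
    ultimately show ?thesis by simp
  qed
  then have "((\<lambda>x. \<Sum>i\<le>degree p. coeff p i * (x ^ i * exp (- c * x)))
      \<longlongrightarrow> (\<Sum>i\<le>degree p. coeff p i * 0)) at_top"
    by (intro tendsto_sum tendsto_mult tendsto_const)
  then show ?thesis
    by (simp add: poly_altdef sum_distrib_right mult.assoc)
qed

text \<open>For \<open>p = 1\<close> this is the classical flat function
  \<open>exp (- c / x)\<close>, extended by zero to the left half-line.\<close>

definition bump_fun :: "real \<Rightarrow> real poly \<Rightarrow> real \<Rightarrow> real" where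
  "bump_fun c p x = (if x > 0 then poly p (inverse x) * exp (- c * inverse x) else 0)"

lemma bump_fun_tendsto_0_right:
  assumes "c > 0"
  shows "(bump_fun c p \<longlongrightarrow> 0) (at_right 0)"
proof -
  have "((\<lambda>x. poly p (inverse x) * exp (- c * inverse x)) \<longlongrightarrow> 0) (at_right 0)"
    by (rule filterlim_compose[OF poly_mult_exp_tendsto_0[OF assms] filterlim_inverse_at_top_right])
  then show ?thesis
    by (rule Lim_transform_eventually)
      (auto simp: bump_fun_def eventually_at_right_less eventually_at_filter)
qed

text \<open>The chain rule for \<open>inverse x\<close> contributes \<open>x\<close> to the power
  -2, which is the polynomial \<open>[:0, 0, 1:]\<close> evaluated at \<open>inverse x\<close>. Only
  the point 0 needs a limit argument.\<close>

lemma bump_fun_deriv: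
  assumes "c > 0"
  shows "(bump_fun c p has_real_derivative
      bump_fun c ([:0, 0, 1:] * (smult c p - pderiv p)) x) (at x)"
proof -
  consider "x > 0" | "x < 0" | "x = 0" by linarith
  then show ?thesis
  proof cases
    case 1
    have "((\<lambda>x. poly p (inverse x) * exp (- c * inverse x)) has_real_derivative
      bump_fun c ([:0, 0, 1:] * (smult c p - pderiv p)) x) (at x)"
      using 1
      by (auto intro!: derivative_eq_intros DERIV_chain2[OF poly_DERIV]
          simp: bump_fun_def field_simps power2_eq_square)
    then show ?thesis
      by (rule has_field_derivative_transform_within_open[where S="{0<..}"])
         (use 1 in \<open>auto simp: bump_fun_def\<close>)
  next
    case 2
    have "((\<lambda>x. 0) has_real_derivative 0) (at x)"
      by simp
    then have "(bump_fun c p has_real_derivative 0) (at x)"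
      by (rule has_field_derivative_transform_within_open[where S="{..<0}"])
         (use 2 in \<open>auto simp: bump_fun_def\<close>)
    then show ?thesis
      using 2 by (simp add: bump_fun_def)
  next
    case 3
    have "((\<lambda>h. bump_fun c p h / h) \<longlongrightarrow> 0) (at_left 0)"
      by (rule tendsto_eventually) (auto simp: bump_fun_def eventually_at_filter)
    moreover have "((\<lambda>h. bump_fun c p h / h) \<longlongrightarrow> 0) (at_right 0)"
      \<comment> \<open>Dividing by \<open>h\<close> multiplies the polynomial by its variable, so
        the difference quotient at 0 is again a bump function.\<close>
      using bump_fun_tendsto_0_right[OF assms, of "[:0, 1:] * p"]
      by (rule Lim_transform_eventually)
        (auto simp: bump_fun_def eventually_at_filter field_simps)
    ultimately have "((\<lambda>h. bump_fun c p h / h) \<longlongrightarrow> 0) (at 0)"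
      using filterlim_split_at by blast
    then show ?thesis
      using 3 by (simp add: DERIV_def bump_fun_def)
  qed
qed

text \<open>
  A class of differentiable functions that is closed under \<^const>\<open>deriv\<close> consists of smooth
  functions; this one avoids formulas for iterated derivatives. The polynomial factor is what
  makes the class closed.
\<close>

inductive_set bump_algebra :: "(real \<Rightarrow> real) set" where
  bump: "c > 0 \<Longrightarrow> (\<lambda>t. bump_fun c p (m * t + k)) \<in> bump_algebra"
| add: "f \<in> bump_algebra \<Longrightarrow> g \<in> bump_algebra \<Longrightarrow> (\<lambda>t. f t + g t) \<in> bump_algebra"
| mult: "f \<in> bump_algebra \<Longrightarrow> g \<in> bump_algebra \<Longrightarrow> (\<lambda>t. f t * g t) \<in> bump_algebra"

lemma bump_algebra_deriv:
  assumes "f \<in> bump_algebra"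
  shows "(\<forall>t. f differentiable (at t)) \<and> deriv f \<in> bump_algebra"
  using assms
proof induction
  case (bump c p m k)
  \<comment> \<open>The slope \<open>m\<close> of the inner affine map is absorbed into the
    polynomial, so the derivative has the form of the rule \<open>bump\<close> again.\<close>
  let ?q = "smult m ([:0, 0, 1:] * (smult c p - pderiv p))"
  have "((\<lambda>t. bump_fun c p (m * t + k)) has_real_derivative bump_fun c ?q (m * t + k)) (at t)" for t
    by (rule DERIV_cong[OF DERIV_chain2[OF bump_fun_deriv[OF bump]]])
       (auto intro!: derivative_eq_intros simp: bump_fun_def)
  moreover from this have "deriv (\<lambda>t. bump_fun c p (m * t + k)) = (\<lambda>t. bump_fun c ?q (m * t + k))"
    by (auto intro!: DERIV_imp_deriv)
  moreover have "(\<lambda>t. bump_fun c ?q (m * t + k)) \<in> bump_algebra"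
    by (rule bump_algebra.bump[OF bump])
  ultimately show ?case
    unfolding real_differentiable_def by force
next
  case (add f g)
  then have "deriv (\<lambda>t. f t + g t) = (\<lambda>t. deriv f t + deriv g t)"
    by (auto simp: field_differentiable_def real_differentiable_def)
  then show ?case
    using add by (auto intro: bump_algebra.add)
next
  case (mult f g)
  then have "deriv (\<lambda>t. f t * g t) = (\<lambda>t. f t * deriv g t + deriv f t * g t)"
    by (auto simp: field_differentiable_def real_differentiable_def)
  then show ?case
    using mult by (auto intro!: bump_algebra.add bump_algebra.mult)
qed

lemma bump_algebra_smooth:
  assumes "f \<in> bump_algebra"
  shows "(deriv ^^ n) f differentiable (at t)"
proof -
  have "(deriv ^^ n) f \<in> bump_algebra" for n
    by (induction n) (simp_all add: assms bump_algebra_deriv)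
  then show ?thesis
    using bump_algebra_deriv by blast
qed

section \<open>Functions determined by their interval integrals\<close>

text \<open>Open intervals form an intersection-stable generator of the Borel sets, and the sets
  over which \<open>f\<close> integrates to zero form a Dynkin system. Hence all Borel sets have
  integral zero, so the density \<open>f\<close> vanishes.\<close>

lemma AE_zero_if_interval_integrals_zero:
  fixes f :: "real \<Rightarrow> 'b::{second_countable_topology, banach}"
  assumes f: "integrable lborel f"
    and zero: "\<And>a b. a < b \<Longrightarrow> (LINT x:{a<..<b}|lborel. f x) = 0"
  shows "AE x in lborel. f x = 0"
proof (rule sigma_finite_measure.density_zero[OF lborel.sigma_finite_measure_axioms f])
  have int: "set_integrable lborel A f" if "A \<in> sets lborel" for A
    using that f by (simp add: set_integrable_def integrable_mult_indicator)
  \<comment> \<open>The integral over the whole line is what the complement case of the induction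
    needs.\<close>
  have UNIV: "integral\<^sup>L lborel f = 0"
  proof -
    have "(\<lambda>n. LINT x:{- real n<..<real n}|lborel. f x) \<longlonglongrightarrow> (LINT x:(\<Union>n. {- real n<..<real n})|lborel. f x)"
      by (rule set_integral_cont_up) (auto simp: incseq_def int)
    moreover have "(\<Union>n. {- real n<..<real n}) = UNIV"
    proof -
      have "\<exists>n. - real n < x \<and> x < real n" for x :: real
        using reals_Archimedean2[of "\<bar>x\<bar>"] by (metis abs_less_iff minus_less_iff)
      then show ?thesis by auto
    qed
    moreover have "(LINT x:{- real n<..<real n}|lborel. f x) = 0" for n
      \<comment> \<open>For \<open>n = 0\<close> the interval is empty and \<open>zero\<close> does
        not apply.\<close>
      using zero[of "- real n" "real n"] by (cases "n = 0") (simp_all add: set_lebesgue_integral_def)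
    ultimately show ?thesis
      by (simp add: set_lebesgue_integral_def LIMSEQ_const_iff)
  qed
  fix A :: "real set" assume "A \<in> sets lborel"
  let ?G = "range (\<lambda>(a, b). box a b :: real set)"
  have "Int_stable ?G"
    by (auto simp: Int_stable_def)
  moreover have "?G \<subseteq> Pow UNIV" by auto
  moreover have "A \<in> sigma_sets UNIV ?G"
    using \<open>A \<in> sets lborel\<close> by (simp add: borel_eq_box)
  moreover have empty: "(LINT x:{}|lborel. f x) = 0"
    by (simp add: set_lebesgue_integral_def)
  ultimately show "(LINT x:A|lborel. f x) = 0"
  proof (induction rule: sigma_sets_induct_disjoint)
    case (basic A)
    then show ?case
      using zero by (auto simp: box_real) (metis greaterThanLessThan_empty_iff not_less empty)
  next
    case empty
    show ?case by (simp add: set_lebesgue_integral_def)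
  next
    case (compl A)
    then have A: "A \<in> sets lborel"
      by (simp add: borel_eq_box)
    have "(LINT x:A \<union> (UNIV - A)|lborel. f x) = (LINT x:A|lborel. f x) + (LINT x:UNIV - A|lborel. f x)"
      using A by (intro set_integral_Un int) auto
    then show ?case
      using compl UNIV by (simp add: set_lebesgue_integral_def)
  next
    case (union A)
    then have "A i \<in> sets lborel" for i
      by (auto simp: borel_eq_box)
    then have "(LINT x:(\<Union>i. A i)|lborel. f x) = (\<Sum>i. LINT x:A i|lborel. f x)"
      using union.hyps(1)
      by (intro lebesgue_integral_countable_add int) (auto simp: disjoint_family_on_def)
    then show ?case
      using union by simp
  qed
qed

section \<open>Strong measurability and square integrability\<close>

lemma strongly_measurable_compose:
  assumes "strongly_measurable M f" and "\<And>y. isCont \<phi> y"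
  shows "strongly_measurable M (\<lambda>x. \<phi> (f x))"
proof -
  obtain s where s: "\<And>n::nat. simple_function M (s n)" "AE t in M. (\<lambda>n. s n t) \<longlonglongrightarrow> f t"
    using assms(1) unfolding strongly_measurable_def by blast
  have "simple_function M (\<lambda>t. \<phi> (s n t))" for n
    using simple_function_compose[OF s(1), of \<phi> n] by (simp add: comp_def)
  moreover have "AE t in M. (\<lambda>n. \<phi> (s n t)) \<longlonglongrightarrow> \<phi> (f t)"
    using s(2) by eventually_elim (rule isCont_tendsto_compose[OF assms(2)])
  ultimately show ?thesis
    unfolding strongly_measurable_def by (intro exI[of _ "\<lambda>n t. \<phi> (s n t)"]) simp
qed

text \<open>The simple functions converge only almost everywhere. Their \<open>lim\<close> is a
  measurable function agreeing with \<open>f\<close> off a null set, and completeness of Lebesgue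
  measure transfers measurability to \<open>f\<close>.\<close>

lemma strongly_measurable_imp_borel_measurable:
  fixes f :: "'a::euclidean_space \<Rightarrow> 'b::euclidean_space"
  assumes f: "strongly_measurable (lebesgue_on S) f" and S: "S \<in> sets lebesgue"
  shows "f \<in> borel_measurable (lebesgue_on S)"
proof -
  obtain s where s: "\<And>n::nat. simple_function (lebesgue_on S) (s n)"
      "AE t in lebesgue_on S. (\<lambda>n. s n t) \<longlonglongrightarrow> f t"
    using f unfolding strongly_measurable_def by blast
  have "(\<lambda>t. lim (\<lambda>n. s n t)) \<in> borel_measurable (lebesgue_on S)"
    by (intro borel_measurable_lim_metric borel_measurable_simple_function s(1))
  then have "(\<lambda>t. indicator S t *\<^sub>R lim (\<lambda>n. s n t)) \<in> borel_measurable lebesgue"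
    using S by (subst (asm) borel_measurable_restrict_space_iff) auto
  moreover have "AE t in lebesgue. indicator S t *\<^sub>R lim (\<lambda>n. s n t) = indicator S t *\<^sub>R f t"
    using s(2) S by (subst (asm) AE_restrict_space_iff) (auto simp: indicator_def limI)
  ultimately have "(\<lambda>t. indicator S t *\<^sub>R f t) \<in> borel_measurable lebesgue"
    by (rule borel_measurable_AE)
  then show ?thesis
    using S by (subst borel_measurable_restrict_space_iff) auto
qed

lemma bochner_L2_bounded_linear:
  assumes g: "bochner_L2 T g" and "bounded_linear \<phi>"
  shows "bochner_L2 T (\<lambda>t. \<phi> (g t))"
proof -
  interpret bounded_linear \<phi> by fact
  let ?M = "lebesgue_on {0<..<T}"
  obtain K where K: "\<And>x. norm (\<phi> x) \<le> norm x * K"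
    using bounded by blast
  have sm: "strongly_measurable ?M (\<lambda>t. \<phi> (g t))"
    using g by (intro strongly_measurable_compose[of _ g \<phi>] isCont continuous_ident)
      (simp add: bochner_L2_def)
  \<comment> \<open>Borel measurability is derived only for this real-valued function, so the target
    of \<open>\<phi>\<close> may be any normed space.\<close>
  have "strongly_measurable ?M (\<lambda>t. (norm (\<phi> (g t)))\<^sup>2)"
    using sm by (rule strongly_measurable_compose[where \<phi> = "\<lambda>y. (norm y)\<^sup>2"])
      (intro continuous_intros)
  then have meas: "(\<lambda>t. (norm (\<phi> (g t)))\<^sup>2) \<in> borel_measurable ?M"
    by (rule strongly_measurable_imp_borel_measurable) simp
  have "integrable ?M (\<lambda>t. (norm (\<phi> (g t)))\<^sup>2)"
  proof (rule Bochner_Integration.integrable_bound[OF _ meas])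
    show "integrable ?M (\<lambda>t. K\<^sup>2 * (norm (g t))\<^sup>2)"
      using g by (simp add: bochner_L2_def)
    show "AE t in ?M. norm ((norm (\<phi> (g t)))\<^sup>2) \<le> norm (K\<^sup>2 * (norm (g t))\<^sup>2)"
      using power_mono[OF K norm_ge_zero, of _ 2] by (simp add: power_mult_distrib mult.commute)
  qed
  with sm show ?thesis
    by (simp add: bochner_L2_def)
qed

text \<open>The interval has finite measure, so the bound of \<open>norm (f t)\<close> by one plus
  its square gives integrability.\<close>

lemma bochner_L2_imp_integrable:
  fixes f :: "real \<Rightarrow> 'b::euclidean_space"
  assumes "bochner_L2 T f"
  shows "integrable (lebesgue_on {0<..<T}) f"
proof (rule Bochner_Integration.integrable_bound)
  show "integrable (lebesgue_on {0<..<T}) (\<lambda>t. 1 + (norm (f t))\<^sup>2)"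
    using assms
    by (intro Bochner_Integration.integrable_add finite_measure.integrable_const
        finite_measure_lebesgue_on) (simp_all add: bochner_L2_def)
  show "f \<in> borel_measurable (lebesgue_on {0<..<T})"
    using assms by (intro strongly_measurable_imp_borel_measurable) (auto simp: bochner_L2_def)
  have "x \<le> 1 + x\<^sup>2" for x :: real
    using zero_le_power2[of "x - 1/2"] by (simp add: power2_eq_square algebra_simps)
  then show "AE t in lebesgue_on {0<..<T}. norm (f t) \<le> norm (1 + (norm (f t))\<^sup>2)"
    by (simp add: abs_of_nonneg)
qed

section \<open>Test functions and the fundamental lemma\<close>

text \<open>A test function is continuous with compact support, hence bounded and
  measurable.\<close>

lemma integrable_mult_test_function:
  fixes f :: "real \<Rightarrow> real"
  assumes f: "integrable (lebesgue_on {0<..<T}) f" and \<psi>: "\<psi> \<in> test_functions T"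
  shows "integrable (lebesgue_on {0<..<T}) (\<lambda>t. f t * \<psi> t)"
proof -
  have diff: "\<psi> differentiable (at t)" for t
    using \<psi> by (auto simp: test_functions_def dest!: spec[of _ "0::nat"])
  then have cont: "continuous_on A \<psi>" for A
    by (auto intro!: continuous_at_imp_continuous_on differentiable_imp_continuous_within)
  obtain K where K: "compact K" "\<And>t. t \<notin> K \<Longrightarrow> \<psi> t = 0"
    using \<psi> by (auto simp: test_functions_def)
  obtain B where "B > 0" "\<And>t. t \<in> K \<Longrightarrow> norm (\<psi> t) \<le> B"
    using compact_imp_bounded[OF compact_continuous_image[OF cont K(1)]]
    by (auto simp: bounded_pos)
  then have B: "norm (\<psi> t) \<le> B" for t
    using K(2)[of t] by fastforce
  show ?thesis
  proof (rule Bochner_Integration.integrable_bound)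
    show "integrable (lebesgue_on {0<..<T}) (\<lambda>t. B * f t)"
      using f by simp
    have "\<psi> \<in> borel_measurable borel"
      by (intro borel_measurable_continuous_onI cont)
    then have "\<psi> \<in> borel_measurable (lebesgue_on {0<..<T})"
      by (intro measurable_restrict_space1 measurable_completion) simp
    then show "(\<lambda>t. f t * \<psi> t) \<in> borel_measurable (lebesgue_on {0<..<T})"
      using f by (intro borel_measurable_times) auto
    show "AE t in lebesgue_on {0<..<T}. norm (f t * \<psi> t) \<le> norm (B * f t)"
      using B by (simp add: abs_mult mult.commute mult_right_mono order_trans[OF _ abs_ge_self])
  qed
qed

lemma bump_fun_bounds:
  assumes "c > 0"
  shows "0 \<le> bump_fun c 1 x" "bump_fun c 1 x \<le> 1"
  using assms by (auto simp: bump_fun_def)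

text \<open>The number \<open>inverse (real (Suc n))\<close> is both decay rate and shift. For
  positive \<open>x\<close> the exponent tends to 0; for other \<open>x\<close> the shifted argument
  is negative and the value is exactly 0. The shift keeps supports away from the endpoint.\<close>

lemma bump_fun_tendsto_indicator:
  "(\<lambda>n. bump_fun (inverse (real (Suc n))) 1 (x - inverse (real (Suc n))))
    \<longlonglongrightarrow> indicator {0<..} x"
proof (cases "x > 0")
  case True
  let ?e = "\<lambda>n. inverse (real (Suc n))"
  have e: "?e \<longlonglongrightarrow> 0"
    by (rule LIMSEQ_inverse_real_of_nat)
  then have "(\<lambda>n. exp (- ?e n * inverse (x - ?e n))) \<longlonglongrightarrow> exp (- 0 * inverse (x - 0))"
    using True by (intro tendsto_intros) auto
  then have "(\<lambda>n. exp (- ?e n * inverse (x - ?e n))) \<longlonglongrightarrow> indicator {0<..} x"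
    using True by simp
  moreover have "\<forall>\<^sub>F n in sequentially. ?e n < x"
    using order_tendstoD(2)[OF e True] .
  then have "\<forall>\<^sub>F n in sequentially. exp (- ?e n * inverse (x - ?e n)) = bump_fun (?e n) 1 (x - ?e n)"
    by eventually_elim (simp add: bump_fun_def)
  ultimately show ?thesis
    by (rule Lim_transform_eventually)
next
  case False
  then have "x - inverse (real (Suc n)) \<le> 0" for n
    by (smt (verit) inverse_nonnegative_iff_nonnegative of_nat_0_le_iff)
  then have "bump_fun (inverse (real (Suc n))) 1 (x - inverse (real (Suc n))) = 0" for n
    by (simp add: bump_fun_def not_less)
  then show ?thesis
    using False by simp
qed

lemma bump_test_function:
  assumes "c > 0" "0 < a" "b < T"
  shows "(\<lambda>t. bump_fun c 1 (t - a) * bump_fun c 1 (b - t)) \<in> test_functions T"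
proof -
  \<comment> \<open>Both factors are written with explicit slope and offset to match the rule
    \<open>bump\<close>.\<close>
  have "(\<lambda>t. bump_fun c 1 (1 * t + (- a)) * bump_fun c 1 ((- 1) * t + b)) \<in> bump_algebra"
    by (intro bump_algebra.intros assms)
  then have "(deriv ^^ n) (\<lambda>t. bump_fun c 1 (t - a) * bump_fun c 1 (b - t)) differentiable (at t)" for n t
    using bump_algebra_smooth[of "\<lambda>t. bump_fun c 1 (t - a) * bump_fun c 1 (b - t)" n t] by simp
  moreover have "compact {a..b}" "{a..b} \<subseteq> {0<..<T}"
    using assms by auto
  moreover have "bump_fun c 1 (t - a) * bump_fun c 1 (b - t) = 0" if "t \<notin> {a..b}" for t
    using that by (auto simp: bump_fun_def)
  ultimately show ?thesis
    unfolding test_functions_def by blast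
qed

lemma test_functions_imp_interval_integral_zero:
  fixes f :: "real \<Rightarrow> real"
  assumes f: "integrable (lebesgue_on {0<..<T}) f"
    and zero: "\<And>\<psi>. \<psi> \<in> test_functions T \<Longrightarrow> (LINT t|lebesgue_on {0<..<T}. f t * \<psi> t) = 0"
    and ab: "0 \<le> a" "b \<le> T"
  shows "(LINT t|lebesgue_on {0<..<T}. f t * indicator {a<..<b} t) = 0"
proof -
  let ?M = "lebesgue_on {0<..<T}"
  let ?e = "\<lambda>n. inverse (real (Suc n))"
  \<comment> \<open>The support lies in \<open>{a + ?e n..b - ?e n}\<close>, a compact subset of the
    open interval even when \<open>a = 0\<close> or \<open>b = T\<close>. Being bounded by 1, these
    functions leave \<open>norm (f t)\<close> as a dominating function.\<close>
  define \<psi> where "\<psi> n t = bump_fun (?e n) 1 (t - (a + ?e n)) * bump_fun (?e n) 1 (b - ?e n - t)" for n t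
  have \<psi>: "\<psi> n \<in> test_functions T" for n
    unfolding \<psi>_def using ab by (intro bump_test_function) (auto simp: add_nonneg_pos diff_less_eq intro: le_less_trans)
  have "(\<lambda>n. LINT t|?M. f t * \<psi> n t) \<longlonglongrightarrow> (LINT t|?M. f t * indicator {a<..<b} t)"
  proof (rule integral_dominated_convergence)
    show "integrable ?M (\<lambda>t. norm (f t))"
      using f by simp
    show "(\<lambda>t. f t * \<psi> n t) \<in> borel_measurable ?M" for n
      using integrable_mult_test_function[OF f \<psi>] by auto
    have "(\<lambda>t. indicator {a<..<b} t :: real) \<in> borel_measurable ?M"
      by (intro measurable_restrict_space1 measurable_completion) simp
    then show "(\<lambda>t. f t * indicator {a<..<b} t) \<in> borel_measurable ?M"
      using f by (intro borel_measurable_times) auto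
    have "(\<lambda>n. \<psi> n t) \<longlonglongrightarrow> indicator {a<..<b} t" for t
    proof -
      have "(\<lambda>n. \<psi> n t) \<longlonglongrightarrow> indicator {0<..} (t - a) * indicator {0<..} (b - t)"
        using tendsto_mult[OF bump_fun_tendsto_indicator[of "t - a"] bump_fun_tendsto_indicator[of "b - t"]]
        by (simp add: \<psi>_def algebra_simps)
      also have "indicator {0<..} (t - a) * indicator {0<..} (b - t) = (indicator {a<..<b} t :: real)"
        by (auto simp: indicator_def)
      finally show ?thesis .
    qed
    then show "AE t in ?M. (\<lambda>n. f t * \<psi> n t) \<longlonglongrightarrow> f t * indicator {a<..<b} t"
      by (intro AE_I2 tendsto_intros)
    have "\<bar>\<psi> n t\<bar> \<le> 1" for n t
      using bump_fun_bounds[of "?e n"] by (auto simp: \<psi>_def abs_mult mult_le_one)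
    then show "AE t in ?M. norm (f t * \<psi> n t) \<le> norm (f t)" for n
      by (intro AE_I2) (simp add: abs_mult mult_left_le)
  qed
  then show ?thesis
    using zero[OF \<psi>] by (simp add: LIMSEQ_const_iff)
qed

text \<open>The criterion by interval integrals concerns \<open>lborel\<close>, while
  \<open>f\<close> is only Lebesgue measurable on \<open>(0,T)\<close>. So \<open>f\<close> is
  extended by zero to \<open>F\<close> and replaced by a Borel representative
  \<open>G\<close>.\<close>

lemma fundamental_lemma_calculus_of_variations:
  fixes f :: "real \<Rightarrow> real"
  assumes f: "integrable (lebesgue_on {0<..<T}) f"
    and zero: "\<And>\<psi>. \<psi> \<in> test_functions T \<Longrightarrow> (LINT t|lebesgue_on {0<..<T}. f t * \<psi> t) = 0"
  shows "AE t in lebesgue_on {0<..<T}. f t = 0"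
proof -
  define F where "F t = indicator {0<..<T} t *\<^sub>R f t" for t
  have F: "integrable lebesgue F"
    using f unfolding F_def by (subst (asm) integrable_restrict_space) auto
  then obtain G where G: "G \<in> borel_measurable lborel" and FG: "AE t in lborel. F t = G t"
    using completion_ex_borel_measurable_real[of F lborel] by auto
  from FG have FG': "AE t in lebesgue. F t = G t"
    by (rule AE_completion)
  have G_leb: "G \<in> borel_measurable lebesgue"
    using G by (rule measurable_completion)
  have "integrable lebesgue G"
    using F G_leb FG' by (rule integrable_cong_AE_imp)
  then have int_G: "integrable lborel G"
    using G by (simp add: integrable_completion)
  have "AE t in lborel. G t = 0"
  proof (rule AE_zero_if_interval_integrals_zero[OF int_G])
    fix a b :: real assume "a < b"
    have "(LINT t:{a<..<b}|lborel. G t) = (LINT t|lebesgue. indicator {a<..<b} t *\<^sub>R G t)"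
      unfolding set_lebesgue_integral_def using G by (intro integral_completion[symmetric]) simp
    also have "\<dots> = (LINT t|lebesgue. indicator {a<..<b} t *\<^sub>R F t)"
      using FG' G_leb F
      by (intro integral_cong_AE borel_measurable_scaleR borel_measurable_indicator) auto
    \<comment> \<open>\<open>F\<close> vanishes outside \<open>(0,T)\<close>, so an arbitrary
      interval may be cut down to one inside it.\<close>
    also have "\<dots> = (LINT t|lebesgue. indicator {0<..<T} t *\<^sub>R (f t * indicator {max 0 a<..<min T b} t))"
      by (intro Bochner_Integration.integral_cong) (auto simp: F_def indicator_def)
    also have "\<dots> = (LINT t|lebesgue_on {0<..<T}. f t * indicator {max 0 a<..<min T b} t)"
      by (rule integral_restrict_space[symmetric]) auto
    also have "\<dots> = 0"
      by (rule test_functions_imp_interval_integral_zero[OF f zero]) auto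
    finally show "(LINT t:{a<..<b}|lborel. G t) = 0" .
  qed
  then have "AE t in lebesgue. G t = 0"
    by (rule AE_completion)
  with FG' have "AE t in lebesgue. F t = 0"
    by eventually_elim simp
  then show ?thesis
    by (subst AE_restrict_space_iff) (auto simp: F_def)
qed

section \<open>Uniqueness and transport of generalized derivatives\<close>

lemma has_gelfand_deriv_unique:
  fixes j :: "'v::real_normed_vector \<Rightarrow>\<^sub>L 'y::real_inner"
  assumes sep: "separable_space (euclidean :: 'v topology)"
    and g: "has_gelfand_deriv T j u g" and h: "has_gelfand_deriv T j u h"
  shows "AE t in lebesgue_on {0<..<T}. g t = h t"
proof -
  let ?M = "lebesgue_on {0<..<T}"
  have int: "integrable ?M (\<lambda>t. blinfun_apply (k t) v)" if "has_gelfand_deriv T j u k" for k v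
    using that unfolding has_gelfand_deriv_def
    by (intro bochner_L2_imp_integrable bochner_L2_bounded_linear[of T k "\<lambda>k. blinfun_apply k v"]
        blinfun.bounded_linear_left) auto
  have eq: "AE t in ?M. blinfun_apply (g t) v = blinfun_apply (h t) v" for v
  proof -
    have "AE t in ?M. blinfun_apply (g t) v - blinfun_apply (h t) v = 0"
    proof (rule fundamental_lemma_calculus_of_variations)
      fix \<psi> assume \<psi>: "\<psi> \<in> test_functions T"
      have "(LINT t|?M. (g t v - h t v) * \<psi> t) = (LINT t|?M. g t v * \<psi> t) - (LINT t|?M. h t v * \<psi> t)"
        using integrable_mult_test_function[OF int \<psi>] g h by (simp add: left_diff_distrib)
      also have "\<dots> = 0"
        using g h \<psi> by (simp add: has_gelfand_deriv_def)
      finally show "(LINT t|?M. (g t v - h t v) * \<psi> t) = 0" .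
    qed (intro Bochner_Integration.integrable_diff int g h)
    then show ?thesis by simp
  qed
  obtain C :: "'v set" where C: "countable C" "closure C = UNIV"
    using sep by (auto simp: separable_space_def)
  have "AE t in ?M. \<forall>v\<in>C. blinfun_apply (g t) v = blinfun_apply (h t) v"
    using C(1) eq by (simp add: AE_ball_countable)
  then show ?thesis
  proof eventually_elim
    case (elim t)
    \<comment> \<open>For this fixed \<open>t\<close>, \<open>g t - h t\<close> is a continuous
      functional that vanishes on the dense set \<open>C\<close>.\<close>
    have "g t v = h t v" for v
      using continuous_constant_on_closure[of C "blinfun_apply (g t - h t)" 0 v] elim C(2)
        linear_continuous_on[OF blinfun.bounded_linear_right, of UNIV "g t - h t"]
      by (simp add: blinfun.diff_left)
    then show ?case
      by (rule blinfun_eqI)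
  qed
qed

text \<open>\<open>inv j\<close> is meaningful only on \<open>range j\<close>, so it cannot be
  treated as a linear map by itself. Linearity of the composite is checked after applying the
  injective \<open>j\<close>, which turns it into linearity of \<open>g\<close>.\<close>

lemma bounded_linear_inv_comp:
  assumes j: "linear j" "inj j" and g: "linear g" "\<And>w. g w \<in> range j"
    and bound: "\<And>w. norm (inv j (g w)) \<le> C * norm w"
  shows "bounded_linear (\<lambda>w. inv j (g w))"
proof (rule bounded_linear_intro[where K = C])
  have j_inv: "j (inv j (g w)) = g w" for w
    using g(2) by (simp add: f_inv_into_f)
  show "inv j (g (x + y)) = inv j (g x) + inv j (g y)" for x y
    by (rule injD[OF j(2)]) (simp only: j_inv linear_add[OF j(1)], simp add: linear_add[OF g(1)])
  show "inv j (g (c *\<^sub>R x)) = c *\<^sub>R inv j (g x)" for c x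
    by (rule injD[OF j(2)]) (simp only: j_inv linear_scale[OF j(1)], simp add: linear_scale[OF g(1)])
  show "norm (inv j (g w)) \<le> norm w * C" for w
    using bound by (simp add: mult.commute)
qed

text \<open>Pairing \<open>A (u t)\<close> with \<open>w\<close> is pairing \<open>u t\<close> with
  \<open>B w\<close>, so the defining identity is that of \<open>u\<close> at \<open>B w\<close>.
  Precomposition with \<open>B\<close> is bounded and linear between the duals and therefore
  preserves square integrability.\<close>

lemma has_gelfand_deriv_compose:
  fixes j :: "'v::real_normed_vector \<Rightarrow>\<^sub>L 'y::real_inner"
    and i :: "'w::real_normed_vector \<Rightarrow>\<^sub>L 'x::real_inner"
    and B :: "'w \<Rightarrow>\<^sub>L 'v"
  assumes g: "has_gelfand_deriv T j u g"
    and B: "\<And>y w. A y \<bullet> i w = y \<bullet> j (B w)"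
  shows "has_gelfand_deriv T i (\<lambda>t. A (u t)) (\<lambda>t. g t o\<^sub>L B)"
  using g bochner_L2_bounded_linear[of T g "\<lambda>k. k o\<^sub>L B"]
  by (auto simp: has_gelfand_deriv_def B bounded_bilinear.bounded_linear_left[OF bounded_bilinear_blinfun_compose])

theorem lemma7:
  fixes jV :: "'v::banach \<Rightarrow>\<^sub>L 'y::{real_inner, banach}"
    and jW :: "'w::banach \<Rightarrow>\<^sub>L 'x::{real_inner, banach}"
    and A :: "'y \<Rightarrow>\<^sub>L 'x"
    and u :: "real \<Rightarrow> 'y"
    and T C :: real
  assumes "reflexive_space TYPE('v)" and "separable_space (euclidean :: 'v topology)"
    and "reflexive_space TYPE('w)" and "separable_space (euclidean :: 'w topology)"
    and "gelfand_triple jV" and "gelfand_triple jW"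
    and "T > 0"
    and "\<And>w. adjoint (blinfun_apply A) (blinfun_apply jW w) \<in> range (blinfun_apply jV)"
    and "\<And>w. norm (inv (blinfun_apply jV) (adjoint (blinfun_apply A) (blinfun_apply jW w))) \<le> C * norm w"
    and "bochner_L2 T u" and "in_H1_dual T jV u"
  shows "(\<exists>h. has_gelfand_deriv T jW (\<lambda>t. blinfun_apply A (u t)) h) \<and>
    (\<forall>g h. has_gelfand_deriv T jV u g \<longrightarrow>
       has_gelfand_deriv T jW (\<lambda>t. blinfun_apply A (u t)) h \<longrightarrow>
       (AE t in lebesgue_on {0<..<T}. \<forall>w.
          blinfun_apply (h t) w =
          blinfun_apply (g t)
            (inv (blinfun_apply jV) (adjoint (blinfun_apply A) (blinfun_apply jW w)))))"
proof -
  have A: "bounded_linear (blinfun_apply A)"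
    by (rule blinfun.bounded_linear_right)
  \<comment> \<open>The adjoint of \<open>A\<close> restricted to \<open>W\<close>, as an operator
    into \<open>V\<close>. \<open>Blinfun\<close> reproduces the given function only because that
    function is bounded linear, which is what \<open>B_apply\<close> settles.\<close>
  define B where "B = Blinfun (\<lambda>w. inv (blinfun_apply jV) (adjoint (blinfun_apply A) (blinfun_apply jW w)))"
  have "inj (blinfun_apply jV)"
    using assms(5) by (simp add: gelfand_triple_def dense_embedding_def)
  moreover have "linear (\<lambda>w. adjoint (blinfun_apply A) (blinfun_apply jW w))"
    using linear_compose[OF bounded_linear.linear[OF blinfun.bounded_linear_right] linear_adjoint_hilbert[OF A]]
    by (simp add: comp_def)
  ultimately have B_apply:
    "blinfun_apply B = (\<lambda>w. inv (blinfun_apply jV) (adjoint (blinfun_apply A) (blinfun_apply jW w)))"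
    unfolding B_def using assms(8,9)
    by (intro bounded_linear_Blinfun_apply bounded_linear_inv_comp[where C = C]
        bounded_linear.linear[OF blinfun.bounded_linear_right])
  have "A y \<bullet> jW w = y \<bullet> jV (B w)" for y w
    using assms(8)[of w] by (simp add: B_apply f_inv_into_f inner_adjoint_hilbert[OF A])
  then have deriv: "has_gelfand_deriv T jW (\<lambda>t. A (u t)) (\<lambda>t. g t o\<^sub>L B)"
    if "has_gelfand_deriv T jV u g" for g
    using that by (intro has_gelfand_deriv_compose)
  \<comment> \<open>Both \<open>h\<close> and the composition of \<open>g\<close> with
    \<open>B\<close> are derivatives of \<open>A u\<close>, so uniqueness in the triple of
    \<open>W\<close> identifies them.\<close>
  have "AE t in lebesgue_on {0<..<T}. \<forall>w. h t w = g t (B w)"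
    if "has_gelfand_deriv T jV u g" "has_gelfand_deriv T jW (\<lambda>t. A (u t)) h" for g h
    using has_gelfand_deriv_unique[OF assms(4) that(2) deriv[OF that(1)]]
    by eventually_elim simp
  moreover have "\<exists>h. has_gelfand_deriv T jW (\<lambda>t. A (u t)) h"
    using assms(11) deriv by (auto simp: in_H1_dual_def)
  ultimately show ?thesis
    by (simp add: B_apply)
qed

end
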